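(* If $n=2^m-1$ for some $m\in\mathbb{N}$, then $$|\mathbb{M}_{r}^{r-1}(S_n)| \;\geq\; 2^{|\mathcal{U}(r,n)|}\quad\text{for all } r\geq 4,$$ where $|\mathcal{U}(r,n)|$ satisfies the recursion $$|\mathcal{U}(r+1,n)| = \frac{1}{r+1}\left(\binom{n}{r}-|\mathcal{U}(r,n)|-(n-r+1)\,|\mathcal{U}(r-1,n)|\right)$$ with initial values $|\mathcal{U}(3,n)|=\binom{n}{3}/(n-2)$ and $|\mathcal{U}(4,n)|=\binom{n}{4}/(n-2)$.
   Context: $S_n=\{1,2,\ldots,n\}$. A matroid on $S_n$ is a pair $(S_n,\mathcal{B})$ where $\mathcal{B}$ (the bases) is a non-empty collection of subsets of $S_n$ such that for all $X,Y\in\mathcal{B}$ and all $x\in X-Y$ there exists $y\in Y-X$ with $(X-\{x\})\cup\{y\}\in\mathcal{B}$. Its rank is the common size of its bases, and its independent sets are the subsets of bases. For $0\leq k\leq r\leq n$, $\mathbb{M}_{r}^{k}(S_n)$ denotes the set of all (labelled) rank-$r$ matroids on $S_n$ in which every $k$-element subset of $S_n$ is independent; in particular $\mathbb{M}_{r}^{r-1}(S_n)$ is the set of rank-$r$ paving matroids on $S_n$. For an integer $i$, let $\vec{i}$ be its binary representation, regarded as a vector over $\mathbb{Z}_2$, and let $\oplus$ denote addition of such vectors over $\mathbb{Z}_2$ (bitwise XOR). Define $$\mathcal{U}(r,n)=\{\{i_1,\ldots,i_r\}\subseteq S_n : i_1,\ldots,i_r \text{ distinct},\ \vec{i_1}\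oplus\cdots\oplus\vec{i_r}=\vec{0}\}.$$
   Formalization: The inequality is stated for 4 ≤ r < n: for r > n the matroid set is not defined, and at r = n it fails, e.g. n = r = 7, where 1⊕…⊕7 = 0 gives |U(7,7)| = 1 and right side 2, while there is only one rank-7 matroid on S_7. *)

theory Defs
  imports Complex_Main "HOL-Library.Z2" "HOL-Library.Function_Algebras"
begin

definition ground :: "nat \<Rightarrow> nat set" where
  "ground n = {1..n}"

text \<open>A matroid is a pair of a ground set and its collection of bases.\<close>

definition matroid :: "'a set \<times> 'a set set \<Rightarrow> bool" where
  "matroid M \<longleftrightarrow> (case M of (S, \<B>) \<Rightarrow>
     \<B> \<subseteq> Pow S \<and> \<B> \<noteq> {} \<and>
     (\<forall>X\<in>\<B>. \<forall>Y\<in>\<B>. \<forall>x\<in>X - Y. \<exists>y\<in>Y - X. (X - {x}) \<union> {y} \<in> \<B>))"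

definition has_rank :: "'a set \<times> 'a set set \<Rightarrow> nat \<Rightarrow> bool" where
  "has_rank M r \<longleftrightarrow> (\<forall>X\<in>snd M. card X = r)"

definition indep :: "'a set \<times> 'a set set \<Rightarrow> 'a set \<Rightarrow> bool" where
  "indep M I \<longleftrightarrow> (\<exists>X\<in>snd M. I \<subseteq> X)"

definition matroids :: "nat \<Rightarrow> nat \<Rightarrow> nat \<Rightarrow> (nat set \<times> nat set set) set" where
  "matroids r k n = {M. fst M = ground n \<and> matroid M \<and> has_rank M r \<and>
     (\<forall>I. I \<subseteq> ground n \<and> card I = k \<longrightarrow> indep M I)}"

text \<open>The binary representation of \<open>i\<close> as a vector over the two-element field, least significant
  digit first and padded with zeros to infinite length; addition and zero of such vectors are the
  pointwise ones on functions.\<close>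

definition binary_vec :: "nat \<Rightarrow> (nat \<Rightarrow> bit)" where
  "binary_vec i = (\<lambda>j. of_bool (Bit_Operations.bit i j))"

definition zero_sum_sets :: "nat \<Rightarrow> nat \<Rightarrow> nat set set" where
  "zero_sum_sets r n = {A. A \<subseteq> ground n \<and> card A = r \<and> (\<Sum>i\<in>A. binary_vec i) = 0}"

end

theory Submission
  imports Defs
begin

text \<open>
  \<^emph>\<open>Lower bound.\<close> A zero-sum set is determined by any of its subsets obtained by deleting one
  point, because the deleted point is the sum of the others. So no two zero-sum \<open>r\<close>-sets meet in
  \<open>r - 1\<close> points. Declaring the members of any family with this property to be dependent, and all
  other \<open>r\<close>-sets to be bases, gives a matroid if \<open>0 < r < n\<close> (\<open>sparse_paving_matroid\<close>): wherever
  basis exchange offers two candidates, at most one of them is forbidden. For \<open>r < n\<close> every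
  \<open>(r - 1)\<close>-set has two extensions, so it stays independent and the matroid is paving. Different subfamilies of the
  zero-sum sets have different bases, whence \<open>2 ^ card (zero_sum_sets r n)\<close> matroids.

  \<^emph>\<open>Recursion.\<close> For \<open>n = 2 ^ m - 1\<close> the binary vectors of \<open>0, \<dots>, n\<close> form a group, with \<open>1, \<dots>, n\<close>
  its nonzero elements. So the sum of an \<open>r\<close>-set \<open>A\<close> is zero, or a member \<open>s\<close> of \<open>A\<close>, or a point
  \<open>s\<close> of the ground set outside \<open>A\<close>. In the second case \<open>A - {s}\<close> is a zero-sum set, and \<open>s\<close> can be
  any point outside it; in the third case \<open>insert s A\<close> is a zero-sum set, and \<open>s\<close> can be any of its
  members. Counting the three cases gives \<open>zero_sum_sets_recursion\<close>. Since no single point and no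
  pair of distinct points has sum zero, the recursion also yields the two initial values.
\<close>

section \<open>Sparse paving matroids\<close>

text \<open>For families of \<open>r\<close>-sets this says that distinct members never share \<open>r - 1\<close> points.\<close>

definition sparse_family :: "'a set set \<Rightarrow> bool" where
  "sparse_family F \<longleftrightarrow>
     (\<forall>C a b. a \<notin> C \<and> b \<notin> C \<and> insert a C \<in> F \<and> insert b C \<in> F \<longrightarrow> a = b)"

lemma sparse_family_extension:
  assumes sparse: "sparse_family F"
    and "finite S" "I \<subseteq> S" "card I + 2 \<le> card S"
  shows "\<exists>y\<in>S - I. insert y I \<notin> F"
proof -
  have "card (S - I) = card S - card I"
    using assms by (meson card_Diff_subset finite_subset)
  then have "\<not> card (S - I) \<le> Suc 0" using assms by linarith
  then obtain y z where "y \<in> S - I" "z \<in> S - I" "y \<noteq> z"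
    using card_le_Suc0_iff_eq[of "S - I"] \<open>finite S\<close> by auto
  then show ?thesis using sparse unfolding sparse_family_def by blast
qed

text \<open>If \<open>Y - X\<close> has two points, then exchanging \<open>x\<close> for one or the other gives two sets that
  both extend \<open>X - {x}\<close> by one point, and sparsity lets at most one of them lie in \<open>F\<close>.\<close>

lemma sparse_paving_matroid:
  assumes sparse: "sparse_family F"
    and "finite S" "0 < r" "r < card S"
  shows "matroid (S, {A. A \<subseteq> S \<and> card A = r} - F)" (is "matroid (S, ?B)")
proof -
  have ne: "?B \<noteq> {}"
  proof -
    have "r - 1 \<le> card S" using \<open>r < card S\<close> by simp
    then obtain I where I: "I \<subseteq> S" "card I = r - 1" "finite I"
      by (rule obtain_subset_with_card_n)
    then obtain y where "y \<in> S - I" "insert y I \<notin> F"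
      using sparse_family_extension[of F S I] assms by auto
    then have "insert y I \<in> ?B" using I \<open>0 < r\<close> by auto
    then show ?thesis by blast
  qed
  have ex: "\<exists>y\<in>Y - X. (X - {x}) \<union> {y} \<in> ?B" if X: "X \<in> ?B" and Y: "Y \<in> ?B" and x: "x \<in> X - Y"
    for X Y x
  proof -
    have fin: "finite X" "finite Y" using X Y \<open>finite S\<close> finite_subset by blast+
    have card_diff: "card (X - Y) = card (Y - X)"
      using X Y fin by (simp add: card_Diff_subset_Int Int_commute)
    have swap: "insert y (X - {x}) \<subseteq> S \<and> card (insert y (X - {x})) = r" if "y \<in> Y - X" for y
      using that X Y x fin card_Suc_Diff1[of X x] by auto
    show ?thesis
    proof (cases "card (Y - X) \<le> Suc 0")
      case True
      \<comment> \<open>\<open>X\<close> and \<open>Y\<close> differ by one exchange, so the result of the exchange is \<open>Y\<close> itself.\<close>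
      have "card (X - Y) > 0" using x fin by (metis card_gt_0_iff empty_iff finite_Diff)
      then have "card (X - Y) = 1" "card (Y - X) = 1" using True card_diff by auto
      then obtain x' y where "X - Y = {x'}" "Y - X = {y}" by (meson card_1_singletonE)
      then have "(X - {x}) \<union> {y} = Y" "y \<in> Y - X" using x by auto
      then show ?thesis using Y by blast
    next
      case False
      then obtain y z where "y \<in> Y - X" "z \<in> Y - X" "y \<noteq> z"
        using card_le_Suc0_iff_eq[of "Y - X"] fin by auto
      then have "\<exists>w\<in>Y - X. insert w (X - {x}) \<notin> F"
        using sparse unfolding sparse_family_def by blast
      then show ?thesis using swap by auto
    qed
  qed
  show ?thesis unfolding matroid_def using ne ex by auto
qed

lemma finite_matroids: "finite (matroids r k n)"
proof -
  have "matroids r k n \<subseteq> {ground n} \<times> Pow (Pow (ground n))"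
    unfolding matroids_def matroid_def by fastforce
  then show ?thesis by (rule finite_subset) (simp add: ground_def)
qed

text \<open>Every subfamily of a sparse family is sparse, so each of the \<open>2 ^ card U\<close> choices of dependent
  \<open>r\<close>-sets inside \<open>U\<close> is realised by a matroid.\<close>

lemma sparse_family_paving_bound:
  assumes sparse: "sparse_family U"
    and U: "U \<subseteq> {A. A \<subseteq> ground n \<and> card A = r}"
    and r: "0 < r" "r < n"
  shows "2 ^ card U \<le> card (matroids r (r - 1) n)"
proof -
  define R where "R = {A. A \<subseteq> ground n \<and> card A = r}"
  define \<Phi> where "\<Phi> = (\<lambda>F. (ground n, R - F))"
  have ground: "finite (ground n)" "card (ground n) = n" by (auto simp: ground_def)
  have finU: "finite U" using U ground(1) by (auto intro: finite_subset[of _ "Pow (ground n)"])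
  have "\<Phi> F \<in> matroids r (r - 1) n" if F: "F \<subseteq> U" for F
  proof -
    have sparseF: "sparse_family F"
      using sparse F unfolding sparse_family_def by blast
    have "indep (\<Phi> F) I" if I: "I \<subseteq> ground n" "card I = r - 1" for I
    proof -
      obtain y where y: "y \<in> ground n - I" "insert y I \<notin> F"
        using sparse_family_extension[OF sparseF ground(1) I(1)] I(2) r ground(2) by auto
      have "insert y I \<in> R - F"
        using y I r finite_subset[OF I(1) ground(1)] by (auto simp: R_def)
      then show ?thesis unfolding indep_def \<Phi>_def by auto
    qed
    moreover have "matroid (\<Phi> F)"
      unfolding \<Phi>_def R_def using sparse_paving_matroid[OF sparseF ground(1)] r ground(2) by auto
    ultimately show ?thesis
      unfolding matroids_def by (auto simp: \<Phi>_def has_rank_def R_def)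
  qed
  moreover have "inj_on \<Phi> (Pow U)"
  proof (rule inj_onI)
    fix F G assume *: "F \<in> Pow U" "G \<in> Pow U" "\<Phi> F = \<Phi> G"
    then have "R - F = R - G" "F \<subseteq> R" "G \<subseteq> R" using U by (auto simp: \<Phi>_def R_def)
    then show "F = G" by blast
  qed
  ultimately have "card (Pow U) \<le> card (matroids r (r - 1) n)"
    by (intro card_inj_on_le finite_matroids) auto
  then show ?thesis using finU by (simp add: card_Pow)
qed

section \<open>Binary vectors\<close>

lemma binary_vec_add_self [simp]: "v + v = (0 :: nat \<Rightarrow> bit)"
  by (rule ext) simp

lemma binary_vec_zero [simp]: "binary_vec 0 = 0"
  by (rule ext) (simp add: binary_vec_def)

lemma binary_vec_xor: "binary_vec (Bit_Operations.xor a b) = binary_vec a + binary_vec b"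
  by (rule ext) (simp add: binary_vec_def bit_xor_iff)

lemma inj_binary_vec: "inj binary_vec"
proof (rule injI)
  fix a b assume "binary_vec a = binary_vec b"
  then have "Bit_Operations.bit a j = Bit_Operations.bit b j" for j
    unfolding binary_vec_def by (metis of_bool_eq_iff)
  then show "a = b" by (simp add: bit_eq_iff)
qed

lemmas binary_vec_eq_iff [simp] = inj_eq[OF inj_binary_vec]

lemma binary_vec_eq_zero_iff [simp]: "binary_vec i = 0 \<longleftrightarrow> i = 0"
  using binary_vec_eq_iff[of i 0] by simp

lemma vec_add_eq_zero_iff: "u + v = (0 :: nat \<Rightarrow> bit) \<longleftrightarrow> u = v"
  by (metis add_right_cancel binary_vec_add_self)

text \<open>The binary vectors of the numbers below \<open>2 ^ m\<close> are closed under addition, as the vectors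
  supported on the first \<open>m\<close> digits.\<close>

lemma sum_binary_vec_closed:
  assumes "finite A" "A \<subseteq> {..<2 ^ m}"
  obtains s where "s < 2 ^ m" "(\<Sum>i\<in>A. binary_vec i) = binary_vec s"
proof -
  have "\<exists>s<2 ^ m. (\<Sum>i\<in>A. binary_vec i) = binary_vec s"
    using assms
  proof (induction A rule: finite_induct)
    case empty
    show ?case by (rule exI[of _ 0]) simp
  next
    case (insert x A)
    then obtain s where s: "s < 2 ^ m" "(\<Sum>i\<in>A. binary_vec i) = binary_vec s" by auto
    have "take_bit m (Bit_Operations.xor x s) = Bit_Operations.xor x s"
      using insert.prems s(1) by (simp add: take_bit_xor take_bit_nat_eq_self)
    then have "Bit_Operations.xor x s < 2 ^ m" by (metis take_bit_nat_less_exp)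
    then show ?case using insert.hyps s(2) by (auto simp: binary_vec_xor)
  qed
  then show ?thesis using that by blast
qed

lemma sum_binary_vec_minus:
  assumes "finite A" "s \<in> A"
  shows "(\<Sum>i\<in>A - {s}. binary_vec i) = (\<Sum>i\<in>A. binary_vec i) + binary_vec s"
proof -
  have "(\<Sum>i\<in>A. binary_vec i) + binary_vec s
      = (\<Sum>i\<in>A - {s}. binary_vec i) + (binary_vec s + binary_vec s)"
    unfolding sum.remove[OF assms] by (simp only: ac_simps)
  then show ?thesis by simp
qed

section \<open>Zero-sum sets\<close>

lemma finite_zero_sum_set: "A \<in> zero_sum_sets r n \<Longrightarrow> finite A"
  by (auto simp: zero_sum_sets_def ground_def intro: finite_subset)

lemma finite_zero_sum_sets: "finite (zero_sum_sets r n)"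
  by (rule finite_subset[of _ "Pow (ground n)"]) (auto simp: zero_sum_sets_def ground_def)

text \<open>Adding \<open>a\<close> to \<open>C\<close> gives a zero-sum set only if \<open>a\<close> is the sum of \<open>C\<close>.\<close>

lemma sparse_zero_sum_sets: "sparse_family (zero_sum_sets r n)"
  unfolding sparse_family_def
proof (intro allI impI, elim conjE)
  fix C a b
  assume assms: "a \<notin> C" "b \<notin> C"
    "insert a C \<in> zero_sum_sets r n" "insert b C \<in> zero_sum_sets r n"
  have "finite C" using assms(3) finite_zero_sum_set by fastforce
  then have "binary_vec a = (\<Sum>i\<in>C. binary_vec i)" "binary_vec b = (\<Sum>i\<in>C. binary_vec i)"
    using assms by (auto simp: zero_sum_sets_def vec_add_eq_zero_iff)
  then show "a = b" by (metis binary_vec_eq_iff)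
qed

lemma zero_sum_sets_1: "zero_sum_sets 1 n = {}"
  by (auto simp: zero_sum_sets_def ground_def card_1_singleton_iff)

lemma zero_sum_sets_2: "zero_sum_sets 2 n = {}"
  by (auto simp: zero_sum_sets_def card_2_iff vec_add_eq_zero_iff)

text \<open>The sets that contain the point \<open>s\<close> equal to their sum: such a set arises from exactly
  one pair of a smaller zero-sum set and a point outside it, as the point is recovered
  as the sum.\<close>

lemma card_sum_inside:
  "card {A. A \<subseteq> ground n \<and> card A = Suc k \<and> (\<exists>s\<in>A. (\<Sum>i\<in>A. binary_vec i) = binary_vec s)}
     = card (zero_sum_sets k n) * (n - k)" (is "card ?P = _")
proof -
  let ?Q = "SIGMA B : zero_sum_sets k n. ground n - B"
  have sum_insert: "(\<Sum>i\<in>insert s B. binary_vec i) = binary_vec s" if "(B, s) \<in> ?Q" for B s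
  proof -
    have B: "B \<in> zero_sum_sets k n" and "s \<notin> B" using that by simp_all
    then have "(\<Sum>i\<in>insert s B. binary_vec i) = binary_vec s + (\<Sum>i\<in>B. binary_vec i)"
      by (simp add: finite_zero_sum_set)
    also have "(\<Sum>i\<in>B. binary_vec i) = 0" using B by (simp add: zero_sum_sets_def)
    finally show ?thesis by (simp only: add_0_right)
  qed
  have "bij_betw (\<lambda>(B, s). insert s B) ?Q ?P"
    unfolding bij_betw_def
  proof (intro conjI inj_onI equalityI subsetI)
    fix p q
    assume "p \<in> ?Q" "q \<in> ?Q" "(case p of (B, s) \<Rightarrow> insert s B) = (case q of (B, s) \<Rightarrow> insert s B)"
    moreover obtain B s C t where pq: "p = (B, s)" "q = (C, t)" by (meson surj_pair)
    ultimately have Q: "(B, s) \<in> ?Q" "(C, t) \<in> ?Q" and eq: "insert s B = insert t C" by simp_all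
    have "binary_vec s = binary_vec t"
      using sum_insert[OF Q(1)] sum_insert[OF Q(2)] unfolding eq by (rule trans[OF sym])
    then have "s = t" by simp
    moreover have "s \<notin> B" "t \<notin> C" using Q by blast+
    ultimately show "p = q" using eq pq insert_ident by metis
  next
    fix A assume "A \<in> (\<lambda>(B, s). insert s B) ` ?Q"
    then obtain B s where Q: "(B, s) \<in> ?Q" and A: "A = insert s B" by blast
    then have "B \<subseteq> ground n" "card B = k" "s \<in> ground n" "s \<notin> B"
      by (simp_all add: zero_sum_sets_def)
    moreover have "finite B" using Q finite_zero_sum_set by blast
    ultimately show "A \<in> ?P" using sum_insert[OF Q] A by auto
  next
    fix A assume "A \<in> ?P"
    then obtain s where A: "A \<subseteq> ground n" "card A = Suc k" "s \<in> A"
      "(\<Sum>i\<in>A. binary_vec i) = binary_vec s" by auto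
    have "finite A" using A(2) card.infinite by fastforce
    then have "(A - {s}, s) \<in> ?Q"
      using A sum_binary_vec_minus[of A s] by (auto simp: zero_sum_sets_def)
    moreover have "insert s (A - {s}) = A" using A by auto
    ultimately show "A \<in> (\<lambda>(B, s). insert s B) ` ?Q" by (intro image_eqI[of _ _ "(A - {s}, s)"]) simp_all
  qed
  then have "card ?P = card ?Q" by (simp add: bij_betw_same_card)
  also have "\<dots> = (\<Sum>B\<in>zero_sum_sets k n. card (ground n - B))"
    by (rule card_SigmaI) (auto simp: finite_zero_sum_sets ground_def)
  also have "\<dots> = (\<Sum>B\<in>zero_sum_sets k n. n - k)"
  proof (rule sum.cong[OF refl])
    fix B assume B: "B \<in> zero_sum_sets k n"
    then have "card (ground n - B) = card (ground n) - card B"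
      by (intro card_Diff_subset finite_zero_sum_set) (auto simp: zero_sum_sets_def)
    also have "card (ground n) = n" by (simp add: ground_def)
    also have "card B = k" using B by (simp add: zero_sum_sets_def)
    finally show "card (ground n - B) = n - k" .
  qed
  finally show ?thesis by simp
qed

text \<open>The sets whose sum is a point \<open>s\<close> of the ground set outside them: such a set arises
  from exactly one pair of a larger zero-sum set and a point of it, again because the point is the sum.\<close>

lemma card_sum_outside:
  "card {A. A \<subseteq> ground n \<and> card A = k \<and>
           (\<exists>s\<in>ground n - A. (\<Sum>i\<in>A. binary_vec i) = binary_vec s)}
     = card (zero_sum_sets (Suc k) n) * Suc k" (is "card ?P = _")
proof -
  let ?Q = "SIGMA C : zero_sum_sets (Suc k) n. C"
  have sum_minus: "(\<Sum>i\<in>C - {s}. binary_vec i) = binary_vec s" if "(C, s) \<in> ?Q" for C s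
  proof -
    have C: "C \<in> zero_sum_sets (Suc k) n" and "s \<in> C" using that by simp_all
    then have "(\<Sum>i\<in>C - {s}. binary_vec i) = (\<Sum>i\<in>C. binary_vec i) + binary_vec s"
      by (intro sum_binary_vec_minus finite_zero_sum_set)
    also have "(\<Sum>i\<in>C. binary_vec i) = 0" using C by (simp add: zero_sum_sets_def)
    finally show ?thesis by (simp only: add_0_left)
  qed
  have "bij_betw (\<lambda>(C, s). C - {s}) ?Q ?P"
    unfolding bij_betw_def
  proof (intro conjI inj_onI equalityI subsetI)
    fix p q
    assume "p \<in> ?Q" "q \<in> ?Q" "(case p of (C, s) \<Rightarrow> C - {s}) = (case q of (C, s) \<Rightarrow> C - {s})"
    moreover obtain B s C t where pq: "p = (B, s)" "q = (C, t)" by (meson surj_pair)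
    ultimately have Q: "(B, s) \<in> ?Q" "(C, t) \<in> ?Q" and eq: "B - {s} = C - {t}" by simp_all
    have "binary_vec s = binary_vec t"
      using sum_minus[OF Q(1)] sum_minus[OF Q(2)] unfolding eq by (rule trans[OF sym])
    then have "s = t" by simp
    moreover have "s \<in> B" "t \<in> C" using Q by blast+
    ultimately show "p = q" using eq pq insert_Diff by metis
  next
    fix A assume "A \<in> (\<lambda>(C, s). C - {s}) ` ?Q"
    then obtain C s where Q: "(C, s) \<in> ?Q" and A: "A = C - {s}" by blast
    then have "C \<subseteq> ground n" "card C = Suc k" "s \<in> C"
      by (simp_all add: zero_sum_sets_def)
    moreover have "finite C" using Q finite_zero_sum_set by blast
    ultimately show "A \<in> ?P" using sum_minus[OF Q] A by auto
  next
    fix A assume "A \<in> ?P"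
    then obtain s where A: "A \<subseteq> ground n" "card A = k" "s \<in> ground n - A"
      "(\<Sum>i\<in>A. binary_vec i) = binary_vec s" by auto
    have "finite A" using A(1) finite_subset by (auto simp: ground_def)
    then have "(insert s A, s) \<in> ?Q" using A by (auto simp: zero_sum_sets_def)
    moreover have "insert s A - {s} = A" using A by auto
    ultimately show "A \<in> (\<lambda>(C, s). C - {s}) ` ?Q" by (intro image_eqI[of _ _ "(insert s A, s)"]) simp_all
  qed
  then have "card ?P = card ?Q" by (simp add: bij_betw_same_card)
  also have "\<dots> = (\<Sum>C\<in>zero_sum_sets (Suc k) n. card C)"
    by (rule card_SigmaI) (auto simp: finite_zero_sum_sets intro: finite_zero_sum_set)
  also have "\<dots> = (\<Sum>C\<in>zero_sum_sets (Suc k) n. Suc k)"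
    by (rule sum.cong) (auto simp: zero_sum_sets_def)
  finally show ?thesis by simp
qed

text \<open>The sum of a set of \<open>k + 1\<close> points is zero or again a point, by closure under addition. This
  is where the shape of \<open>n\<close> enters: for other \<open>n\<close> the sum could be larger than \<open>n\<close>.\<close>

lemma zero_sum_sets_recursion:
  assumes n: "n = 2 ^ m - 1"
  shows "card (zero_sum_sets (k + 2) n) * (k + 2) + card (zero_sum_sets (k + 1) n)
           + card (zero_sum_sets k n) * (n - k) = n choose (k + 1)"
proof -
  let ?R = "{A. A \<subseteq> ground n \<and> card A = Suc k}"
  let ?I = "{A. A \<subseteq> ground n \<and> card A = Suc k \<and> (\<exists>s\<in>A. (\<Sum>i\<in>A. binary_vec i) = binary_vec s)}"
  let ?O = "{A. A \<subseteq> ground n \<and> card A = Suc k \<and>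
              (\<exists>s\<in>ground n - A. (\<Sum>i\<in>A. binary_vec i) = binary_vec s)}"
  let ?Z = "zero_sum_sets (Suc k) n"
  have ground: "ground n = {0<..<2 ^ m}" by (auto simp: ground_def n)
  have "A \<in> ?Z \<union> ?I \<union> ?O" if A: "A \<in> ?R" for A
  proof -
    have "finite A" using A card.infinite by fastforce
    moreover have "A \<subseteq> {..<2 ^ m}" using A ground by auto
    ultimately obtain s where "s < 2 ^ m" "(\<Sum>i\<in>A. binary_vec i) = binary_vec s"
      by (rule sum_binary_vec_closed)
    then show ?thesis using A by (cases "s = 0") (auto simp: zero_sum_sets_def ground)
  qed
  then have split: "?R = ?Z \<union> ?I \<union> ?O" by (auto simp: zero_sum_sets_def)
  have fin: "finite ?R" by (rule finite_subset[of _ "Pow (ground n)"]) (auto simp: ground_def)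
  have nonzero: "binary_vec s \<noteq> 0" if "s \<in> ground n" for s using that by (auto simp: ground)
  have ZI: "?Z \<inter> ?I = {}" using nonzero by (fastforce simp: zero_sum_sets_def)
  have ZIO: "(?Z \<union> ?I) \<inter> ?O = {}" using nonzero by (fastforce simp: zero_sum_sets_def)
  have "n choose (k + 1) = card ?R"
    using n_subsets[of "ground n" "Suc k"] by (simp add: ground_def)
  also have "\<dots> = card ?Z + card ?I + card ?O"
    using fin unfolding split by (simp add: card_Un_disjoint[OF _ _ ZI] card_Un_disjoint[OF _ _ ZIO])
  finally show ?thesis unfolding card_sum_inside card_sum_outside by simp
qed

text \<open>This keeps the denominator \<open>n - 2\<close> of the initial values away from zero.\<close>

lemma two_power_minus_1_neq_2: "2 ^ m - 1 \<noteq> (2 :: nat)"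
proof (cases m)
  case (Suc k)
  have "2 * (2 :: nat) ^ k \<noteq> 3" by presburger
  then show ?thesis using Suc by simp
qed simp

lemma binomial_Suc_real:
  "real (Suc k) * real (n choose Suc k) = (real n - real k) * real (n choose k)"
proof (cases "k \<le> n")
  case True
  have "Suc k * (n choose Suc k) = (n - k) * (n choose k)"
    by (simp only: binomial_absorption binomial_absorb_comp)
  then have "real (Suc k) * real (n choose Suc k) = real (n - k) * real (n choose k)"
    by (metis of_nat_mult)
  then show ?thesis using True by (simp add: of_nat_diff)
qed (simp add: binomial_eq_0)

lemma card_zero_sum_sets_3:
  assumes n: "n = 2 ^ m - 1"
  shows "real (card (zero_sum_sets 3 n)) = real (n choose 3) / (real n - 2)"
proof -
  let ?u = "real (card (zero_sum_sets 3 n))"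
  have "card (zero_sum_sets 3 n) * 3 = n choose 2"
    using zero_sum_sets_recursion[OF n, of 1] zero_sum_sets_1[of n] zero_sum_sets_2[of n]
    by (simp add: numeral_eq_Suc)
  then have "3 * ?u = real (n choose 2)"
    by (metis mult.commute of_nat_mult of_nat_numeral)
  moreover have "3 * real (n choose 3) = (real n - 2) * real (n choose 2)"
    using binomial_Suc_real[of 2 n] by simp
  ultimately have "3 * real (n choose 3) = (real n - 2) * (3 * ?u)" by simp
  then have "?u * (real n - 2) = real (n choose 3)" by (simp add: algebra_simps)
  moreover have "n \<noteq> 2" unfolding n by (rule two_power_minus_1_neq_2)
  ultimately show ?thesis by (simp add: eq_divide_eq)
qed

lemma card_zero_sum_sets_4:
  assumes n: "n = 2 ^ m - 1"
  shows "real (card (zero_sum_sets 4 n)) = real (n choose 4) / (real n - 2)"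
proof -
  let ?u = "\<lambda>r. real (card (zero_sum_sets r n))"
  have "card (zero_sum_sets 4 n) * 4 + card (zero_sum_sets 3 n) = n choose 3"
    using zero_sum_sets_recursion[OF n, of 2] zero_sum_sets_2[of n]
    by (simp add: numeral_eq_Suc)
  then have rec: "?u 4 * 4 + ?u 3 = real (n choose 3)"
    by (metis of_nat_add of_nat_mult of_nat_numeral)
  have n2: "n \<noteq> 2" unfolding n by (rule two_power_minus_1_neq_2)
  then have 3: "?u 3 * (real n - 2) = real (n choose 3)"
    unfolding card_zero_sum_sets_3[OF n] by simp
  have "4 * (?u 4 * (real n - 2)) = (?u 4 * 4 + ?u 3) * (real n - 2) - ?u 3 * (real n - 2)"
    by (simp add: distrib_right)
  also have "\<dots> = real (n choose 3) * (real n - 2) - real (n choose 3)"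
    unfolding rec 3 ..
  also have "\<dots> = (real n - 3) * real (n choose 3)" by (simp add: algebra_simps)
  also have "\<dots> = 4 * real (n choose 4)" using binomial_Suc_real[of 3 n] by simp
  finally have "?u 4 * (real n - 2) = real (n choose 4)" by simp
  then show ?thesis using n2 by (simp add: eq_divide_eq)
qed

theorem theorem3p1:
  fixes m n :: nat
  assumes "n = 2 ^ m - 1"
  shows "(\<forall>r. 4 \<le> r \<and> r < n \<longrightarrow>
            card (matroids r (r - 1) n) \<ge> 2 ^ card (zero_sum_sets r n))
       \<and> (\<forall>r\<ge>4. real (card (zero_sum_sets (r + 1) n)) =
            1 / (real r + 1) *
              (real (n choose r) - real (card (zero_sum_sets r n))
                - (real n - real r + 1) * real (card (zero_sum_sets (r - 1) n))))
       \<and> real (card (zero_sum_sets 3 n)) = real (n choose 3) / (real n - 2)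
       \<and> real (card (zero_sum_sets 4 n)) = real (n choose 4) / (real n - 2)"
proof (intro conjI allI impI)
  fix r assume r: "4 \<le> r \<and> r < n"
  show "2 ^ card (zero_sum_sets r n) \<le> card (matroids r (r - 1) n)"
  proof (rule sparse_family_paving_bound)
    show "zero_sum_sets r n \<subseteq> {A. A \<subseteq> ground n \<and> card A = r}"
      by (auto simp: zero_sum_sets_def)
  qed (use r sparse_zero_sum_sets in auto)
next
  fix r :: nat assume "4 \<le> r"
  then obtain k where k: "r = k + 1" by (metis add.commute le_Suc_ex nat_1_add_1 numeral_Bit0 add.assoc)
  let ?u = "\<lambda>r. real (card (zero_sum_sets r n))"
  have "real (n choose r) = ?u (k + 2) * real (k + 2) + ?u (k + 1) + ?u k * real (n - k)"
    unfolding k zero_sum_sets_recursion[OF assms, of k, symmetric]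
    by (simp only: of_nat_add of_nat_mult)
  \<comment> \<open>For \<open>k > n\<close> the truncated difference is harmless, as there are no \<open>k\<close>-subsets.\<close>
  moreover have "?u k * real (n - k) = ?u k * (real n - real k)"
  proof (cases "k \<le> n")
    case False
    have "card A \<le> n" if "A \<subseteq> ground n" for A
      using card_mono[OF _ that] by (simp add: ground_def)
    then have "zero_sum_sets k n = {}" using False by (auto simp: zero_sum_sets_def)
    then show ?thesis by simp
  qed (simp add: of_nat_diff)
  ultimately show "?u (r + 1) = 1 / (real r + 1) *
      (real (n choose r) - ?u r - (real n - real r + 1) * ?u (r - 1))"
    by (simp add: k field_simps)
qed (rule card_zero_sum_sets_3[OF assms] card_zero_sum_sets_4[OF assms])+

end
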